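(* Let $\alpha\in\mathbb{C}$. The semiring $R_+(\alpha)$ is a ring if and only if $\alpha$ is an algebraic number (over $\mathbb{Q}$) that is not a nonnegative integer.
   Context: For $\alpha\in\mathbb{C}$, $R_+(\alpha)$ denotes the set of all finite sums $\sum_{k\ge 0} a_k\binom{\alpha}{k}$ with $a_k\in\mathbb{Z}_{\ge 0}$, where $\binom{\alpha}{k}=\frac{\alpha(\alpha-1)\cdots(\alpha-k+1)}{k!}$ and $\binom{\alpha}{0}=1$. It is closed under the addition and multiplication of $\mathbb{C}$ and contains $0$ and $1$, so it is a semiring under these operations; "is a ring" means that it is also closed under additive inverses. *)

theory Defs
  imports
    Complex_Main
    "HOL-Computational_Algebra.Computational_Algebra"
    "HOL-Algebra.Ring"
begin

definition R_plus :: "complex \<Rightarrow> complex set" where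
  "R_plus \<alpha> = {(\<Sum>k<n. of_nat (a k) * (\<alpha> gchoose k)) | (n :: nat) (a :: nat \<Rightarrow> nat). True}"

definition R_plus_struct :: "complex \<Rightarrow> complex ring" where
  "R_plus_struct \<alpha> = \<lparr>carrier = R_plus \<alpha>, mult = (*), one = 1, zero = 0, add = (+)\<rparr>"

lemma R_plus_zero: "0 \<in> R_plus \<alpha>"
  unfolding R_plus_def by (auto intro!: exI[of _ "0::nat"])

lemma R_plus_scaled_gbinomial: "of_nat c * (\<alpha> gchoose m) \<in> R_plus \<alpha>"
proof -
  have "(\<Sum>k<Suc m. of_nat ((if k = m then c else 0)) * (\<alpha> gchoose k)) = of_nat c * (\<alpha> gchoose m)"
    by simp
  then show ?thesis
    unfolding R_plus_def by (auto intro!: exI[of _ "Suc m"] exI[of _ "\<lambda>k. if k = m then c else 0"])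
qed

lemma R_plus_one: "1 \<in> R_plus \<alpha>"
  using R_plus_scaled_gbinomial[of 1 \<alpha> 0] by simp

lemma R_plus_add:
  assumes "x \<in> R_plus \<alpha>" "y \<in> R_plus \<alpha>"
  shows "x + y \<in> R_plus \<alpha>"
proof -
  have pad: "(\<Sum>k<n. of_nat (a k) * (\<alpha> gchoose k)) =
      (\<Sum>k<max n m. of_nat (if k < n then a k else 0) * (\<alpha> gchoose k))" for a :: "nat \<Rightarrow> nat" and n m
    by (rule sum.mono_neutral_cong_left) auto
  obtain n a where x: "x = (\<Sum>k<n. of_nat (a k) * (\<alpha> gchoose k))"
    using assms(1) unfolding R_plus_def by blast
  obtain m b where y: "y = (\<Sum>k<m. of_nat (b k) * (\<alpha> gchoose k))"
    using assms(2) unfolding R_plus_def by blast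
  have "x + y = (\<Sum>k<max n m. of_nat ((if k < n then a k else 0) + (if k < m then b k else 0))
                   * (\<alpha> gchoose k))"
    unfolding x y pad[of a n m] pad[of b m n] max.commute[of m n]
    by (simp add: sum.distrib[symmetric] algebra_simps)
  then show ?thesis
    unfolding R_plus_def
    by (auto intro!: exI[of _ "max n m"]
        exI[of _ "\<lambda>k. (if k < n then a k else 0) + (if k < m then b k else 0)"])
qed

lemma R_plus_sum: "(\<And>i. i \<in> I \<Longrightarrow> f i \<in> R_plus \<alpha>) \<Longrightarrow> sum f I \<in> R_plus \<alpha>"
  by (induction I rule: infinite_finite_induct) (auto intro: R_plus_zero R_plus_add)

lemma R_plus_of_nat_mult: "x \<in> R_plus \<alpha> \<Longrightarrow> of_nat c * x \<in> R_plus \<alpha>"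
  by (induction c) (auto simp: algebra_simps intro: R_plus_zero R_plus_add)

lemma R_plus_gbinomial_mult: "(\<alpha> gchoose k) * (\<alpha> gchoose l) \<in> R_plus \<alpha>"
proof -
  have step: "(\<alpha> gchoose k) * (\<alpha> - of_nat k gchoose j) =
      of_nat ((k + j) choose k) * (\<alpha> gchoose (k + j))" for j
    using gbinomial_trinomial_revision[of k "k + j" \<alpha>]
    by (simp add: binomial_gbinomial mult.commute)
  have "\<alpha> gchoose l = (\<Sum>j=0..l. (\<alpha> - of_nat k gchoose j) * (of_nat k gchoose (l - j)))"
    using gbinomial_Vandermonde[of "\<alpha> - of_nat k" "of_nat k" l] by simp
  then have "(\<alpha> gchoose k) * (\<alpha> gchoose l) =
      (\<Sum>j=0..l. of_nat (k choose (l - j)) * ((\<alpha> gchoose k) * (\<alpha> - of_nat k gchoose j)))"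
    by (simp add: sum_distrib_left binomial_gbinomial mult_ac)
  then show ?thesis
    by (simp only: step) (intro R_plus_sum R_plus_of_nat_mult R_plus_scaled_gbinomial)
qed

lemma R_plus_mult:
  assumes "x \<in> R_plus \<alpha>" "y \<in> R_plus \<alpha>"
  shows "x * y \<in> R_plus \<alpha>"
proof -
  obtain n a where x: "x = (\<Sum>k<n. of_nat (a k) * (\<alpha> gchoose k))"
    using assms(1) unfolding R_plus_def by blast
  obtain m b where y: "y = (\<Sum>k<m. of_nat (b k) * (\<alpha> gchoose k))"
    using assms(2) unfolding R_plus_def by blast
  have "x * y = (\<Sum>k<n. \<Sum>l<m. of_nat (a k) * (of_nat (b l) * ((\<alpha> gchoose k) * (\<alpha> gchoose l))))"
    unfolding x y sum_product by (simp add: mult_ac)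
  then show ?thesis
    by (simp only:) (intro R_plus_sum R_plus_of_nat_mult R_plus_gbinomial_mult)
qed

lemma semiring_R_plus: "semiring (R_plus_struct \<alpha>)"
  unfolding R_plus_struct_def
  by (intro semiring.intro semiring_axioms.intro abelian_monoidI monoidI)
     (auto simp: R_plus_zero R_plus_one R_plus_add R_plus_mult algebra_simps)

lemma ring_R_plus_iff: "ring (R_plus_struct \<alpha>) \<longleftrightarrow> (\<forall>x \<in> R_plus \<alpha>. - x \<in> R_plus \<alpha>)"
proof
  assume "ring (R_plus_struct \<alpha>)"
  then have "abelian_group (R_plus_struct \<alpha>)"
    by (rule ring.axioms(1))
  from abelian_groupE(6)[OF this] show "\<forall>x \<in> R_plus \<alpha>. - x \<in> R_plus \<alpha>"
    by (auto simp: R_plus_struct_def add_eq_0_iff2)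
next
  assume neg: "\<forall>x \<in> R_plus \<alpha>. - x \<in> R_plus \<alpha>"
  then have "\<forall>x \<in> R_plus \<alpha>. \<exists>y \<in> R_plus \<alpha>. y + x = 0"
    by (metis add.left_inverse)
  then show "ring (R_plus_struct \<alpha>)"
    unfolding R_plus_struct_def
    by (intro ringI abelian_groupI monoidI)
       (auto simp: R_plus_zero R_plus_one R_plus_add R_plus_mult algebra_simps)
qed

end

theory Submission
  imports Defs
begin

text \<open>
  Since \<open>R_plus \<alpha>\<close> is multiplicatively closed, it is a ring iff it contains \<open>-1\<close>. A representation
  of \<open>-1\<close> is a nontrivial polynomial relation for \<open>\<alpha>\<close>, and it is impossible for natural \<open>\<alpha>\<close>, where
  all binomial coefficients are nonnegative integers. Conversely, an algebraic \<open>\<alpha> \<notin> \<nat>\<close> is a root of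
  an integer polynomial \<open>f\<close> that is positive on \<open>\<nat>\<close>: take the square of one of minimal degree. In

  \<open>f(x) \<Sum>\<^sub>m g\<^sub>m (x choose m) = \<Sum>\<^sub>j (\<Sum>\<^sub>m\<^sub>\<le>\<^sub>j g\<^sub>m (j choose m) (\<Delta>^(j-m) f)(m)) (x choose j)\<close>

  the diagonal term \<open>g\<^sub>j f(j)\<close> of the \<open>j\<close>-th coefficient is positive, so \<open>g\<^sub>0 = 1, g\<^sub>1, \<dots>, g\<^sub>N\<close> can be
  chosen successively to make the coefficients up to \<open>N\<close> nonnegative. The later ones involve only
  differences of \<open>f\<close> at points \<open>m > N - deg f\<close>, which are nonnegative for large \<open>N\<close>. As the constant
  coefficient \<open>f(0)\<close> is at least 1, evaluation at \<open>\<alpha>\<close> expresses \<open>-1\<close>.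
\<close>

section \<open>Reduction to -1, and natural \<alpha>\<close>

lemma ring_R_plus_iff_minus_one: "ring (R_plus_struct \<alpha>) \<longleftrightarrow> -1 \<in> R_plus \<alpha>"
  unfolding ring_R_plus_iff
  using R_plus_one R_plus_mult[of "-1" \<alpha>] by force

lemma R_plusI: "(\<Sum>k<n. of_nat (a k) * (\<alpha> gchoose k)) \<in> R_plus \<alpha>"
  unfolding R_plus_def by blast

lemma minus_one_notin_R_plus_of_nat: "-1 \<notin> R_plus (of_nat N)"
proof
  assume "-1 \<in> R_plus (of_nat N)"
  then obtain n a where "-1 = (\<Sum>k<n. of_nat (a k) * (of_nat N gchoose k :: complex))"
    unfolding R_plus_def by blast
  also have "\<dots> = of_nat (\<Sum>k<n. a k * (N choose k))"
    by (simp add: binomial_gbinomial)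
  finally have "of_nat (Suc (\<Sum>k<n. a k * (N choose k))) = (0 :: complex)"
    by (simp only: of_nat_Suc) (metis add.right_inverse)
  then show False
    by (simp only: of_nat_eq_0_iff)
qed

section \<open>A representation of -1 makes \<alpha> algebraic\<close>

lemma coeff_mult_Rats:
  fixes p q :: "'a::field_char_0 poly"
  assumes "\<And>i. coeff p i \<in> \<rat>" "\<And>i. coeff q i \<in> \<rat>"
  shows "coeff (p * q) i \<in> \<rat>"
  unfolding coeff_mult using assms by (intro Rats_sum) auto

text \<open>Passing from \<open>k\<close> to \<open>Suc k\<close> multiplies by the rational linear
  factor (x - k) / (k + 1). Rationality of the coefficients is what later gives
  algebraicity.\<close>

lemma gchoose_poly_exists:
  "\<exists>p :: 'a::field_char_0 poly. (\<forall>i. coeff p i \<in> \<rat>) \<and> (\<forall>x. poly p x = x gchoose k)"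
proof (induction k)
  case 0
  show ?case
    by (intro exI[of _ 1]) auto
next
  case (Suc k)
  then obtain p :: "'a poly" where p: "\<And>i. coeff p i \<in> \<rat>" "\<And>x. poly p x = x gchoose k"
    by blast
  define q :: "'a poly" where "q = [:- of_nat k / of_nat (Suc k), 1 / of_nat (Suc k):]"
  have "coeff q i \<in> \<rat>" for i
    by (auto simp: q_def coeff_pCons split: nat.splits intro!: Rats_divide simp del: of_nat_Suc)
  then have "coeff (q * p) i \<in> \<rat>" for i
    using p(1) by (intro coeff_mult_Rats)
  moreover have "poly (q * p) x = x gchoose Suc k" for x
  proof -
    have "of_nat (Suc k) * (x gchoose Suc k) = (x - of_nat k) * (x gchoose k)"
      using gbinomial_mult_1[of x k] by (simp add: algebra_simps)
    then have "x gchoose Suc k = (x - of_nat k) * (x gchoose k) / of_nat (Suc k)"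
      by (simp add: eq_divide_eq mult.commute del: of_nat_Suc)
    then show ?thesis
      by (simp add: q_def p(2) diff_divide_distrib ring_distribs del: of_nat_Suc)
  qed
  ultimately show ?case
    by blast
qed

lemma minus_one_in_R_plus_imp_algebraic:
  assumes "-1 \<in> R_plus \<alpha>"
  shows "algebraic \<alpha>"
proof -
  obtain n a where eq: "-1 = (\<Sum>k<n. of_nat (a k) * (\<alpha> gchoose k))"
    using assms unfolding R_plus_def by blast
  obtain b :: "nat \<Rightarrow> complex poly"
    where b: "\<And>k i. coeff (b k) i \<in> \<rat>" "\<And>k x. poly (b k) x = x gchoose k"
    using gchoose_poly_exists by metis
  define P where "P = 1 + (\<Sum>k<n. smult (of_nat (a k)) (b k))"
  have P: "poly P x = 1 + (\<Sum>k<n. of_nat (a k) * (x gchoose k))" for x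
    by (simp add: P_def poly_sum b(2))
  show ?thesis
  proof (rule algebraicI')
    show "coeff P i \<in> \<rat>" for i
      by (auto simp: P_def coeff_sum b(1) intro!: Rats_add Rats_sum)
    \<comment> \<open>The relation is nontrivial because its value at 0 is not 0: otherwise -1 would
      lie in \<open>R_plus 0\<close>.\<close>
    have "(\<Sum>k<n. of_nat (a k) * (0 gchoose k)) \<noteq> (-1 :: complex)"
      using minus_one_notin_R_plus_of_nat[of 0] R_plusI[of a 0 n] by auto
    then have "poly P 0 \<noteq> 0"
      unfolding P add_eq_0_iff .
    then show "P \<noteq> 0"
      by auto
    show "poly P \<alpha> = 0"
      unfolding P eq[symmetric] by simp
  qed
qed

section \<open>Integer polynomials positive on the naturals\<close>

lemma map_poly_of_int_mult:
  "map_poly of_int (p * q) = (map_poly of_int p * map_poly of_int q :: 'a::comm_ring_1 poly)"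
  by (intro poly_eqI) (simp add: coeff_map_poly coeff_mult)

lemma poly_map_poly_of_int_of_nat:
  "poly (map_poly of_int p) (of_nat n :: 'a::comm_ring_1) = of_int (poly p (int n))"
  by (induction p) (simp_all add: map_poly_pCons)

text \<open>Minimal degree excludes a natural root n: the monic factor X - n could be divided out
  over the integers, and the quotient would still vanish at \<alpha> \<noteq> n. Squaring then
  settles all signs.\<close>

lemma algebraic_obtains_positive_poly:
  fixes \<alpha> :: "'a::field_char_0"
  assumes "algebraic \<alpha>" "\<alpha> \<notin> \<nat>"
  obtains f :: "int poly"
  where "poly (map_poly of_int f) \<alpha> = 0" "lead_coeff f > 0" "\<And>n. poly f (int n) > 0"
proof -
  define root where "root p \<longleftrightarrow> p \<noteq> 0 \<and> poly (map_poly of_int p) \<alpha> = 0" for p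
  obtain p0 where "root p0"
    using algebraicE'[OF assms(1)] unfolding root_def by metis
  then obtain p where p: "root p" and min: "\<And>q. root q \<Longrightarrow> degree p \<le> degree q"
    by (metis arg_min_natI arg_min_nat_le)
  have "poly p (int n) \<noteq> 0" for n
  proof
    assume "poly p (int n) = 0"
    then obtain q where q: "p = [:- int n, 1:] * q"
      unfolding poly_eq_0_iff_dvd by blast
    have "q \<noteq> 0"
      using p q by (auto simp: root_def)
    have "(\<alpha> - of_nat n) * poly (map_poly of_int q) \<alpha> = 0"
      using p unfolding root_def q map_poly_of_int_mult poly_mult
      by (simp add: map_poly_pCons del: mult_pCons_left)
    moreover have "\<alpha> \<noteq> of_nat n"
      using assms(2) by auto
    ultimately have "root q"
      using \<open>q \<noteq> 0\<close> by (simp add: root_def)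
    moreover have "degree p = Suc (degree q)"
      unfolding q using \<open>q \<noteq> 0\<close> by (subst degree_mult_eq) auto
    ultimately show False
      using min by fastforce
  qed
  then have "poly (p * p) (int n) > 0" for n
    by (simp add: zero_less_mult_iff linorder_neq_iff) (metis linorder_neq_iff)
  moreover have "lead_coeff (p * p) > 0"
    using p unfolding lead_coeff_mult root_def
    by (metis leading_coeff_0_iff not_square_less_zero mult_eq_0_iff linorder_neqE)
  moreover have "poly (map_poly of_int (p * p)) \<alpha> = 0"
    using p by (simp add: map_poly_of_int_mult root_def)
  ultimately show thesis
    using that by blast
qed

section \<open>Newton expansions at natural points\<close>

text \<open>Here \<open>h m i\<close> is the \<open>i\<close>-th forward difference of \<open>p\<close> at \<open>m\<close>.\<close>

lemma newton_expansion:
  fixes p :: "int poly"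
  obtains h :: "nat \<Rightarrow> nat \<Rightarrow> int"
  where "\<And>m x. poly (map_poly of_int p) (x :: 'a::field_char_0) =
           (\<Sum>i\<le>degree p. of_int (h m i) * (x - of_nat m gchoose i))"
    and "\<And>m i. i > degree p \<Longrightarrow> h m i = 0"
    and "lead_coeff p > 0 \<Longrightarrow> \<exists>M. \<forall>m\<ge>M. \<forall>i\<le>degree p. h m i > 0"
proof -
  have "\<exists>h :: nat \<Rightarrow> nat \<Rightarrow> int.
      (\<forall>m x. poly (map_poly of_int p) (x :: 'a) =
           (\<Sum>i\<le>degree p. of_int (h m i) * (x - of_nat m gchoose i))) \<and>
      (\<forall>m i. i > degree p \<longrightarrow> h m i = 0) \<and>
      (lead_coeff p > 0 \<longrightarrow> (\<exists>M. \<forall>m\<ge>M. \<forall>i\<le>degree p. h m i > 0))"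
  proof (induction p)
    case 0
    show ?case
      by (intro exI[of _ "\<lambda>_ _. 0"]) auto
  next
    case (pCons a p)
    show ?case
    proof (cases "p = 0")
      case True
      then show ?thesis
        by (intro exI[of _ "\<lambda>_ i. if i = 0 then a else 0"]) (auto simp: map_poly_pCons)
    next
      case False
      then have deg: "degree (pCons a p) = Suc (degree p)"
        by simp
      from pCons.IH obtain h :: "nat \<Rightarrow> nat \<Rightarrow> int"
        where h: "\<And>m x. poly (map_poly of_int p) (x :: 'a) =
            (\<Sum>i\<le>degree p. of_int (h m i) * (x - of_nat m gchoose i))"
          and h0: "\<And>m i. i > degree p \<Longrightarrow> h m i = 0"
          and hpos: "lead_coeff p > 0 \<Longrightarrow> \<exists>M. \<forall>m\<ge>M. \<forall>i\<le>degree p. h m i > 0"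
        by blast
      \<comment> \<open>Coefficients of a + x p(x), collected from \<open>mult\<close> below. At
        \<open>i = 0\<close> the truncated \<open>i - 1\<close> is harmless, since its factor is
        0.\<close>
      define h' where "h' m i = (if i = 0 then a else 0) + int (m + i) * h m i
          + int i * h m (i - 1)" for m i
      have "poly (map_poly of_int (pCons a p)) x =
          (\<Sum>i\<le>Suc (degree p). of_int (h' m i) * (x - of_nat m gchoose i))" for m and x :: 'a
      proof -
        let ?d = "degree p" and ?b = "\<lambda>i. x - of_nat m gchoose i"
        have mult: "x * ?b i = of_nat (m + i) * ?b i + of_nat (Suc i) * ?b (Suc i)" for i
          using gbinomial_mult_1[of "x - of_nat m" i] by (simp add: algebra_simps)
        have "poly (map_poly of_int (pCons a p)) x =
            of_int a + (\<Sum>i\<le>?d. of_int (h m i) * (x * ?b i))"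
          by (simp add: map_poly_pCons h[of x m] sum_distrib_left mult_ac)
        also have "\<dots> = of_int a + (\<Sum>i\<le>?d. of_int (int (m + i) * h m i) * ?b i)
            + (\<Sum>i\<le>?d. of_int (int (Suc i) * h m i) * ?b (Suc i))"
          unfolding mult by (simp add: ring_distribs sum.distrib mult_ac)
        also have "of_int a = (\<Sum>i\<le>Suc ?d. of_int (if i = 0 then a else 0) * ?b i)"
          by (subst sum.atMost_Suc_shift) simp
        also have "(\<Sum>i\<le>?d. of_int (int (m + i) * h m i) * ?b i) =
            (\<Sum>i\<le>Suc ?d. of_int (int (m + i) * h m i) * ?b i)"
          by (simp add: h0)
        also have "(\<Sum>i\<le>?d. of_int (int (Suc i) * h m i) * ?b (Suc i)) =
            (\<Sum>i\<le>Suc ?d. of_int (int i * h m (i - 1)) * ?b i)"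
          by (subst sum.atMost_Suc_shift) simp
        finally show ?thesis
          unfolding h'_def by (simp only: of_int_add ring_distribs sum.distrib)
      qed
      moreover have "h' m i = 0" if "i > Suc (degree p)" for m i
        using that by (simp add: h'_def h0)
      moreover have "\<exists>M. \<forall>m\<ge>M. \<forall>i\<le>Suc (degree p). h' m i > 0" if lc: "lead_coeff p > 0"
      proof -
        from hpos[OF lc] obtain M where M: "\<And>m i. m \<ge> M \<Longrightarrow> i \<le> degree p \<Longrightarrow> h m i > 0"
          by blast
        \<comment> \<open>For \<open>i = 0\<close>, \<open>h m 0\<close> is at least 1, so m > |a|
          outweighs a negative \<open>a\<close>. For \<open>i > 0\<close> the shifted term is
          already positive, even at the new top index, where \<open>h m i = 0\<close>.\<close>
        have "h' m i > 0" if m: "m \<ge> max M (nat \<bar>a\<bar> + 1)" and i: "i \<le> Suc (degree p)" for m i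
        proof (cases i)
          case 0
          have "int m * 1 \<le> int m * h m 0"
            using M[of m 0] m by (intro mult_left_mono) auto
          moreover have "h' m i = a + int m * h m 0"
            by (simp add: h'_def 0)
          ultimately show ?thesis
            using m by linarith
        next
          case (Suc j)
          then have "int i * h m (i - 1) > 0"
            using M[of m j] m i by simp
          moreover have "h m i \<ge> 0"
            using M[of m i] m h0[of i m] by (cases "i \<le> degree p") (auto simp: less_imp_le)
          then have "int (m + i) * h m i \<ge> 0"
            by simp
          ultimately show ?thesis
            by (simp add: h'_def Suc)
        qed
        then show ?thesis
          by blast
      qed
      ultimately show ?thesis
        unfolding deg using False by (intro exI[of _ h']) auto
    qed
  qed
  then show thesis
    using that by blast
qed

section \<open>Choice of the multiplier and the representation of -1\<close>

text \<open>Row j involves only g up to index j, so a new entry leaves earlier rows intact. With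
  \<open>s\<close> the part of the new row already fixed, the entry |s| suffices, as a positive
  integer diagonal is at least 1.\<close>

lemma nonneg_triangular_combination:
  fixes A :: "nat \<Rightarrow> nat \<Rightarrow> int"
  assumes "\<And>j. A j j > 0"
  shows "\<exists>g :: nat \<Rightarrow> nat. g 0 = 1 \<and> (\<forall>j\<le>N. (\<Sum>m\<le>j. int (g m) * A j m) \<ge> 0)"
proof (induction N)
  case 0
  show ?case
    using assms[of 0] by (intro exI[of _ "\<lambda>_. 1"]) auto
next
  case (Suc N)
  then obtain g where g: "g 0 = 1" "\<And>j. j \<le> N \<Longrightarrow> (\<Sum>m\<le>j. int (g m) * A j m) \<ge> 0"
    by blast
  define s where "s = (\<Sum>m\<le>N. int (g m) * A (Suc N) m)"
  define g' where "g' = g(Suc N := nat \<bar>s\<bar>)"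
  have "\<bar>s\<bar> * 1 \<le> \<bar>s\<bar> * A (Suc N) (Suc N)"
    using assms[of "Suc N"] by (intro mult_left_mono) auto
  then have "(\<Sum>m\<le>Suc N. int (g' m) * A (Suc N) m) \<ge> 0"
    by (simp add: g'_def s_def[symmetric])
  moreover have "(\<Sum>m\<le>j. int (g' m) * A j m) \<ge> 0" if "j \<le> N" for j
    using g(2)[OF that] that by (simp add: g'_def)
  ultimately show ?case
    using g(1) by (intro exI[of _ g']) (auto simp: g'_def le_Suc_eq)
qed

lemma algebraic_imp_minus_one_in_R_plus:
  assumes "algebraic \<alpha>" "\<alpha> \<notin> \<nat>"
  shows "-1 \<in> R_plus \<alpha>"
proof -
  obtain f where f: "poly (map_poly of_int f) \<alpha> = 0" "lead_coeff f > 0"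
      "\<And>n. poly f (int n) > 0"
    using algebraic_obtains_positive_poly[OF assms] by blast
  define d where "d = degree f"
  obtain h :: "nat \<Rightarrow> nat \<Rightarrow> int"
    where h: "\<And>m x. poly (map_poly of_int f) (x :: complex) =
        (\<Sum>i\<le>d. of_int (h m i) * (x - of_nat m gchoose i))"
      and h0: "\<And>m i. i > d \<Longrightarrow> h m i = 0"
      and hpos: "\<exists>M. \<forall>m\<ge>M. \<forall>i\<le>d. h m i > 0"
    using newton_expansion[of f, where 'a = complex] f(2) unfolding d_def by metis
  from hpos obtain M where M: "\<And>m i. m \<ge> M \<Longrightarrow> i \<le> d \<Longrightarrow> h m i > 0"
    by blast
  have h_diag: "h m 0 = poly f (int m)" for m
  proof -
    have "of_int (poly f (int m)) = (\<Sum>i\<le>d. of_int (h m i) * (0 gchoose i :: complex))"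
      using h[of "of_nat m" m] by (simp add: poly_map_poly_of_int_of_nat)
    also have "\<dots> = (\<Sum>i\<le>d. if i = 0 then of_int (h m 0) else 0)"
      by (intro sum.cong) (auto simp: gbinomial_0_left)
    finally show ?thesis
      by simp
  qed
  \<comment> \<open>\<open>A j m\<close> is the coefficient of \<open>\<alpha> gchoose j\<close> in
    f(\<alpha>) times \<open>\<alpha> gchoose m\<close>, as \<open>expand\<close> shows.\<close>
  define A where "A j m = (if m \<le> j then h m (j - m) * int (j choose m) else 0)" for j m
  have A_diag: "A j j > 0" for j
    by (simp add: A_def h_diag f(3))
  \<comment> \<open>If j > M + d, then j - m \<le> d forces m > M, where the differences are
    positive; for j - m > d they vanish.\<close>
  define N where "N = M + d"
  obtain g :: "nat \<Rightarrow> nat"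
    where g: "g 0 = 1" "\<And>j. j \<le> N \<Longrightarrow> (\<Sum>m\<le>j. int (g m) * A j m) \<ge> 0"
    using nonneg_triangular_combination[of A N, OF A_diag] by blast
  define c where "c j = (\<Sum>m\<le>N. int (g m) * A j m)" for j
  have c_nonneg: "c j \<ge> 0" for j
  proof (cases "j \<le> N")
    case True
    have "c j = (\<Sum>m\<le>j. int (g m) * A j m)"
      unfolding c_def using True by (intro sum.mono_neutral_right) (auto simp: A_def)
    then show ?thesis
      using g(2)[OF True] by simp
  next
    case False
    have "A j m \<ge> 0" for m
    proof (cases "j - m \<le> d")
      case True
      then have "m \<ge> M"
        using False by (simp add: N_def)
      then show ?thesis
        using M[of m "j - m"] True by (simp add: A_def)
    qed (simp add: A_def h0)
    then show ?thesis
      unfolding c_def by (intro sum_nonneg) simp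
  qed
  have "c 0 = (\<Sum>m\<le>N. if m = 0 then h 0 0 else 0)"
    unfolding c_def by (intro sum.cong) (auto simp: A_def g(1))
  then have c0: "c 0 \<ge> 1"
    using h_diag[of 0] f(3)[of 0] by simp
  have expand: "poly (map_poly of_int f) \<alpha> * (\<alpha> gchoose m) =
      (\<Sum>j\<le>N + d. of_int (A j m) * (\<alpha> gchoose j))" if "m \<le> N" for m
  proof -
    have "h m i * ((\<alpha> - of_nat m gchoose i) * (\<alpha> gchoose m)) =
        A (m + i) m * (\<alpha> gchoose (m + i))" for i
      using gbinomial_trinomial_revision[of m "m + i" \<alpha>]
      by (simp add: A_def binomial_gbinomial mult_ac)
    then have "poly (map_poly of_int f) \<alpha> * (\<alpha> gchoose m) =
        (\<Sum>i\<le>d. of_int (A (m + i) m) * (\<alpha> gchoose (m + i)))"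
      unfolding h[of \<alpha> m] sum_distrib_right by (simp add: mult.assoc)
    also have "\<dots> = (\<Sum>j\<in>(+) m ` {..d}. of_int (A j m) * (\<alpha> gchoose j))"
      by (subst sum.reindex) auto
    \<comment> \<open>The added terms vanish: \<open>A j m = 0\<close> for j < m by definition, and
      for j > m + d by \<open>h0\<close>.\<close>
    also have "\<dots> = (\<Sum>j\<le>N + d. of_int (A j m) * (\<alpha> gchoose j))"
    proof (intro sum.mono_neutral_left ballI)
      fix j assume j: "j \<in> {..N + d} - (+) m ` {..d}"
      have "j - m > d" if "m \<le> j"
        using j that image_eqI[of j "(+) m" "j - m" "{..d}"] by force
      then show "of_int (A j m) * (\<alpha> gchoose j) = 0"
        by (simp add: A_def h0)
    qed (use that in auto)
    finally show ?thesis .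
  qed
  have "0 = (\<Sum>m\<le>N. of_nat (g m) * (poly (map_poly of_int f) \<alpha> * (\<alpha> gchoose m)))"
    by (simp add: f(1))
  also have "\<dots> = (\<Sum>m\<le>N. \<Sum>j\<le>N + d. of_int (int (g m) * A j m) * (\<alpha> gchoose j))"
    by (intro sum.cong refl) (simp add: expand sum_distrib_left mult.assoc)
  also have "\<dots> = (\<Sum>j\<le>N + d. of_int (c j) * (\<alpha> gchoose j))"
    by (subst sum.swap) (simp add: c_def sum_distrib_right)
  finally have relation: "(\<Sum>j\<le>N + d. of_int (c j) * (\<alpha> gchoose j)) = 0"
    by simp
  \<comment> \<open>Since \<open>c 0\<close> is at least 1, subtracting 1 keeps it nonnegative, so
    \<open>nat\<close> loses nothing.\<close>
  define a where "a j = nat (if j = 0 then c 0 - 1 else c j)" for j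
  have "of_nat (a j) * (\<alpha> gchoose j) = of_int (c j) * (\<alpha> gchoose j) - (if j = 0 then 1 else 0)" for j
    using c0 c_nonneg[of j] by (simp add: a_def)
  then have "(\<Sum>j\<le>N + d. of_nat (a j) * (\<alpha> gchoose j)) = -1"
    by (simp add: sum_subtractf relation)
  then show ?thesis
    using R_plusI[where n = "Suc (N + d)" and a = a and \<alpha> = \<alpha>] by (simp only: lessThan_Suc_atMost)
qed

theorem theorem1p3:
  fixes \<alpha> :: complex
  shows "ring (R_plus_struct \<alpha>) \<longleftrightarrow> algebraic \<alpha> \<and> \<alpha> \<notin> \<nat>"
  unfolding ring_R_plus_iff_minus_one
  using minus_one_in_R_plus_imp_algebraic algebraic_imp_minus_one_in_R_plus
    minus_one_notin_R_plus_of_nat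
  by (auto elim!: Nats_cases)

end
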